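(* Let $P$ be a combinatorially symmetric row-stochastic $S\times S$ matrix (the transition matrix of a discrete-time homogeneous Markov chain) whose graph $\mathcal{G}(P)$ is connected, and let $Z\subseteq\{1,\ldots,S\}$ be a set of observed states that is a zero forcing set of $\mathcal{G}(P)$. Then the Markov chain is uniquely determined by the dynamics of the observed states. That is, if $P'$ is any combinatorially symmetric row-stochastic $S\times S$ matrix with $\mathcal{G}(P')=\mathcal{G}(P)$ and $(P'^n)_{ij}=(P^n)_{ij}$ for all $i,j\in Z$ and all $n\in\mathbb{N}$, then $P'=P$.
   Context: Markov chains are homogeneous and finite with states $1,\ldots,S$. A discrete-time chain has a transition matrix $P$ with real entries $(P)_{ij}\ge 0$, where $(P)_{ij}=\mathbb{P}(X_{n+1}=j\mid X_n=i)$, and $P$ is row stochastic: $\sum_{j=1}^S (P)_{ij}=1$ for all $i$. A matrix $M$ is combinatorially symmetric if for all indices $i,j$, $(M)_{ij}\neq 0$ implies $(M)_{ji}\neq 0$. For a combinatorially symmetric matrix $M$ of order $S$, $\mathcal{G}(M)$ is the simple undirected graph on the vertices $1,\ldots,S$ in which $\{i,j\}$ with $i<j$ is an edge if and only if $(M)_{ij}\neq 0$ (diagonal entries are ignored). Zero forcing: given a simple graph, colour the vertices of a subset $Z$ blue. The colour propagates by the rules: (1) a blue vertex remains blue; (2) if a blue vertex $i$ has exactly one non-blue neighbour $j$, then $j$ becomes blue. $Z$ is a zero forcing set if eventually all vertices become blue. The dynamics of the observed states $Z$ is the collection of all values $(P^n)_{ij}$ with $i,j\in Z$ and $n\in\mathbb{N}$.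 The structure of the model (its graph) is regarded as known, and the matrix entries are the unknown parameters. *)

theory Defs
  imports "Jordan_Normal_Form.Matrix" "Graph_Theory.Pair_Digraph" "Graph_Theory.Digraph_Component"
begin

text \<open>
  The states \<open>1, \<dots>, S\<close> are represented by the indices \<open>0, \<dots>, S - 1\<close>, following the
  index convention of the matrix library.
\<close>

definition row_stochastic :: "real mat \<Rightarrow> bool" where
  "row_stochastic P \<longleftrightarrow>
     (\<forall>i < dim_row P. \<forall>j < dim_col P. P $$ (i, j) \<ge> 0) \<and>
     (\<forall>i < dim_row P. (\<Sum>j < dim_col P. P $$ (i, j)) = 1)"

text \<open>Intended for square matrices only, as is \<open>matrix_graph\<close> below.\<close>

definition combinatorially_symmetric :: "'a :: zero mat \<Rightarrow> bool" where
  "combinatorially_symmetric M \<longleftrightarrow>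
     (\<forall>i < dim_row M. \<forall>j < dim_row M. M $$ (i, j) \<noteq> 0 \<longrightarrow> M $$ (j, i) \<noteq> 0)"

text \<open>
  A simple undirected graph is represented as a symmetric loop-free digraph (locale
  \<open>pair_graph\<close>): the edge \<open>{i, j}\<close>, \<open>i < j\<close>, is present iff the entry \<open>(i, j)\<close> of \<open>M\<close> is
  nonzero, and it is encoded by the two arcs \<open>(i, j)\<close> and \<open>(j, i)\<close>.
\<close>

definition matrix_graph :: "'a :: zero mat \<Rightarrow> nat pair_pre_digraph" where
  "matrix_graph M =
     \<lparr> pverts = {..<dim_row M},
       parcs = {(i, j). i < dim_row M \<and> j < dim_row M \<and>
                  (i < j \<and> M $$ (i, j) \<noteq> 0 \<or> j < i \<and> M $$ (j, i) \<noteq> 0)} \<rparr>"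

lemma pair_graph_matrix_graph: "pair_graph (matrix_graph M)"
proof
  show "finite (parcs (matrix_graph M))"
    by (rule finite_subset [of _ "{..<dim_row M} \<times> {..<dim_row M}"])
       (auto simp: matrix_graph_def)
qed (auto simp: matrix_graph_def symmetric_def sym_def)

lemma arc_matrix_graph_iff:
  assumes "combinatorially_symmetric M"
  shows "(i, j) \<in> parcs (matrix_graph M) \<longleftrightarrow>
           i < dim_row M \<and> j < dim_row M \<and> i \<noteq> j \<and> M $$ (i, j) \<noteq> 0"
  using assms by (auto simp: matrix_graph_def combinatorially_symmetric_def nat_neq_iff)

definition neighbours :: "'v pair_pre_digraph \<Rightarrow> 'v \<Rightarrow> 'v set" where
  "neighbours G i = {j. i \<rightarrow>\<^bsub>with_proj G\<^esub> j}"

text \<open>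
  One round of the colour change rule, applied to all blue vertices simultaneously;
  \<open>B\<close> is the set of blue vertices.
\<close>

definition colour_change :: "'v pair_pre_digraph \<Rightarrow> 'v set \<Rightarrow> 'v set" where
  "colour_change G B = B \<union> {j. \<exists>i\<in>B. neighbours G i - B = {j}}"

definition zero_forcing_set :: "'v pair_pre_digraph \<Rightarrow> 'v set \<Rightarrow> bool" where
  "zero_forcing_set G Z \<longleftrightarrow>
     Z \<subseteq> pverts G \<and> (\<exists>t. (colour_change G ^^ t) Z = pverts G)"

end

theory Submission
  imports Defs
begin

text \<open>
  Zero forcing produces, one vertex at a time, a nonvanishing scaling \<open>d\<close> such that
  \<open>d\<^sub>i (P'\<^sup>n)\<^sub>i\<^sub>j = (P\<^sup>n)\<^sub>i\<^sub>j d\<^sub>j\<close> for all \<open>n\<close> and all blue \<open>i, j\<close>: when \<open>i\<close> forces \<open>k\<close>, expanding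
  \<open>P\<^sup>n\<^sup>+\<^sup>1 = P P\<^sup>n = P\<^sup>n P\<close> at \<open>i\<close> leaves the terms at \<open>k\<close> as the only unknown ones. So \<open>P\<close>
  and \<open>P'\<close> are diagonally similar. As both matrices have row sums \<open>1\<close>, the scaling \<open>d\<close> is
  harmonic for \<open>P\<close>, hence constant by the maximum principle on the connected graph.
\<close>

section \<open>Neighbours and entries of matrix powers\<close>

lemma neighbours_iff: "j \<in> neighbours G i \<longleftrightarrow> (i, j) \<in> parcs G"
  by (auto simp: neighbours_def arcs_ends_def arc_to_ends_def)

lemma pow_mat_Suc_index_right:
  assumes "A \<in> carrier_mat n n" "i < n" "j < n"
  shows "(A ^\<^sub>m Suc m) $$ (i, j) = (\<Sum>l<n. (A ^\<^sub>m m) $$ (i, l) * A $$ (l, j))"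
proof -
  have "A ^\<^sub>m m \<in> carrier_mat n n"
    using assms(1) by simp
  then show ?thesis
    using assms by (simp add: scalar_prod_def atLeast0LessThan)
qed

lemma pow_mat_Suc_left:
  assumes "A \<in> carrier_mat n n"
  shows "A ^\<^sub>m Suc m = A * A ^\<^sub>m m"
proof (induction m)
  case 0
  then show ?case using assms by auto
next
  case (Suc m)
  have "A ^\<^sub>m Suc (Suc m) = (A * A ^\<^sub>m m) * A"
    using Suc by (metis pow_mat.simps(2))
  also have "\<dots> = A * A ^\<^sub>m Suc m"
    using assms by (simp add: assoc_mult_mat[of _ n n _ n _ n])
  finally show ?case .
qed

lemma pow_mat_Suc_index_left:
  assumes "A \<in> carrier_mat n n" "i < n" "j < n"
  shows "(A ^\<^sub>m Suc m) $$ (i, j) = (\<Sum>l<n. A $$ (i, l) * (A ^\<^sub>m m) $$ (l, j))"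
proof -
  have "A ^\<^sub>m m \<in> carrier_mat n n"
    using assms(1) by simp
  then show ?thesis
    unfolding pow_mat_Suc_left[OF assms(1)]
    using assms by (simp add: scalar_prod_def atLeast0LessThan)
qed

section \<open>Extending a diagonal scaling to a forced vertex\<close>

text \<open>With \<open>D\<close> the diagonal matrix of \<open>d\<close>, this is
  \<open>D A'^m = A^m D\<close> read on the block \<open>B\<close>. Plain equality of powers would
  not propagate: a force determines the entries at the new vertex only up to a factor, which
  \<open>d\<close> absorbs.\<close>

definition scaled_powers_on ::
    "'a :: field mat \<Rightarrow> 'a mat \<Rightarrow> (nat \<Rightarrow> 'a) \<Rightarrow> nat set \<Rightarrow> bool" where
  "scaled_powers_on A A' d B \<longleftrightarrow>
     (\<forall>i\<in>B. d i \<noteq> 0) \<and>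
     (\<forall>i\<in>B. \<forall>j\<in>B. \<forall>m. d i * (A' ^\<^sub>m m) $$ (i, j) = (A ^\<^sub>m m) $$ (i, j) * d j)"

lemma sum_lessThan_eq_sum_insert:
  fixes f :: "nat \<Rightarrow> 'a :: comm_monoid_add"
  assumes "B \<subseteq> {..<n}" "k < n" "k \<notin> B"
    and "\<And>l. l < n \<Longrightarrow> l \<notin> insert k B \<Longrightarrow> f l = 0"
  shows "(\<Sum>l<n. f l) = (\<Sum>l\<in>B. f l) + f k"
proof -
  have "finite B"
    using assms(1) finite_subset by blast
  then have "(\<Sum>l\<in>insert k B. f l) = (\<Sum>l\<in>B. f l) + f k"
    using assms(3) by (simp add: add.commute)
  moreover have "(\<Sum>l<n. f l) = (\<Sum>l\<in>insert k B. f l)"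
    using assms by (intro sum.mono_neutral_right) auto
  ultimately show ?thesis by simp
qed

text \<open>Row and column \<open>i\<close> of both matrices are supported in
  \<open>insert k B\<close>. Subtracting the known terms over \<open>B\<close> from the identity for
  exponent \<open>Suc m\<close> therefore leaves the one for exponent \<open>m\<close> at
  \<open>k\<close>.\<close>

lemma scaled_powers_on_force:
  fixes A A' :: "'a :: field mat"
  assumes A: "A \<in> carrier_mat n n" "combinatorially_symmetric A"
    and A': "A' \<in> carrier_mat n n" "combinatorially_symmetric A'"
    and graph: "matrix_graph A' = matrix_graph A"
    and B: "B \<subseteq> {..<n}" "i \<in> B"
    and force: "neighbours (matrix_graph A) i - B = {k}"
    and d: "scaled_powers_on A A' d B"
  shows "\<exists>d'. scaled_powers_on A A' d' (insert k B)"
proof -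
  have arc: "(u, v) \<in> parcs (matrix_graph A) \<longleftrightarrow> u < n \<and> v < n \<and> u \<noteq> v \<and> A $$ (u, v) \<noteq> 0" for u v
    using arc_matrix_graph_iff[OF A(2), of u v] A(1) by simp
  have arc': "(u, v) \<in> parcs (matrix_graph A) \<longleftrightarrow> u < n \<and> v < n \<and> u \<noteq> v \<and> A' $$ (u, v) \<noteq> 0" for u v
    using arc_matrix_graph_iff[OF A'(2), of u v] A'(1) graph by simp
  have sym: "(u, v) \<in> parcs (matrix_graph A) \<longleftrightarrow> (v, u) \<in> parcs (matrix_graph A)" for u v
    by (auto simp: matrix_graph_def)
  have i: "i < n"
    using B by auto
  have ik: "(i, k) \<in> parcs (matrix_graph A)" and k: "k \<notin> B"
    using force neighbours_iff by fastforce+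
  then have kn: "k < n" and nz: "A $$ (i, k) \<noteq> 0" "A $$ (k, i) \<noteq> 0" "A' $$ (i, k) \<noteq> 0" "A' $$ (k, i) \<noteq> 0"
    using arc arc' sym by blast+
  have "(i, l) \<notin> parcs (matrix_graph A)" if "l \<notin> insert k B" for l
    using that force neighbours_iff by fastforce
  \<comment> \<open>The graph ignores diagonal entries, but \<open>i\<close> lies in
    \<open>B\<close>, so here \<open>l\<close> differs from \<open>i\<close> and a missing arc does
    mean a zero entry.\<close>
  then have zero: "A $$ (i, l) = 0" "A $$ (l, i) = 0" "A' $$ (i, l) = 0" "A' $$ (l, i) = 0"
    if "l < n" "l \<notin> insert k B" for l
    using that arc arc' sym i B(2) by (metis insertCI)+
  have row: "(M ^\<^sub>m Suc m) $$ (i, j) = (\<Sum>l\<in>B. M $$ (i, l) * (M ^\<^sub>m m) $$ (l, j)) + M $$ (i, k) * (M ^\<^sub>m m) $$ (k, j)"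
    if "M \<in> {A, A'}" "j < n" for M m j
    using that A(1) A'(1) i
    by (subst pow_mat_Suc_index_left[of M n]; (intro sum_lessThan_eq_sum_insert)?)
       (auto simp: B kn k zero)
  have col: "(M ^\<^sub>m Suc m) $$ (j, i) = (\<Sum>l\<in>B. (M ^\<^sub>m m) $$ (j, l) * M $$ (l, i)) + (M ^\<^sub>m m) $$ (j, k) * M $$ (k, i)"
    if "M \<in> {A, A'}" "j < n" for M m j
    using that A(1) A'(1) i
    by (subst pow_mat_Suc_index_right[of M n]; (intro sum_lessThan_eq_sum_insert)?)
       (auto simp: B kn k zero)
  have d0: "d u \<noteq> 0" if "u \<in> B" for u
    using d that by (auto simp: scaled_powers_on_def)
  have dpow: "d u * (A' ^\<^sub>m m) $$ (u, v) = (A ^\<^sub>m m) $$ (u, v) * d v" if "u \<in> B" "v \<in> B" for u v m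
    using d that by (auto simp: scaled_powers_on_def)
  have d1: "d u * A' $$ (u, v) = A $$ (u, v) * d v" if "u \<in> B" "v \<in> B" for u v
    using dpow[OF that, of 1] A(1) A'(1) by simp
  \<comment> \<open>The value forced by the desired identity at \<open>(i, k)\<close> with exponent
    1.\<close>
  define c where "c = d i * A' $$ (i, k) / A $$ (i, k)"
  have c0: "c \<noteq> 0"
    using d0 B(2) nz by (simp add: c_def)
  \<comment> \<open>Expand both sides of \<open>dpow\<close> at \<open>(i, j)\<close> with exponent
    \<open>Suc m\<close> along row \<open>i\<close>; the sums over \<open>B\<close> agree term by
    term.\<close>
  have kB: "c * (A' ^\<^sub>m m) $$ (k, j) = (A ^\<^sub>m m) $$ (k, j) * d j" if j: "j \<in> B" for j m
  proof -
    have jn: "j < n"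
      using j B by auto
    have "(\<Sum>l\<in>B. d i * (A' $$ (i, l) * (A' ^\<^sub>m m) $$ (l, j))) = (\<Sum>l\<in>B. A $$ (i, l) * (A ^\<^sub>m m) $$ (l, j) * d j)"
    proof (rule sum.cong)
      fix l assume l: "l \<in> B"
      have "d i * (A' $$ (i, l) * (A' ^\<^sub>m m) $$ (l, j)) = A $$ (i, l) * (d l * (A' ^\<^sub>m m) $$ (l, j))"
        using d1[OF B(2) l] by (simp flip: mult.assoc)
      also have "\<dots> = A $$ (i, l) * (A ^\<^sub>m m) $$ (l, j) * d j"
        using dpow[OF l j] by (simp add: mult.assoc)
      finally show "d i * (A' $$ (i, l) * (A' ^\<^sub>m m) $$ (l, j)) = A $$ (i, l) * (A ^\<^sub>m m) $$ (l, j) * d j" .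
    qed simp
    moreover have "d i * (A' ^\<^sub>m Suc m) $$ (i, j) = (A ^\<^sub>m Suc m) $$ (i, j) * d j"
      by (rule dpow[OF B(2) j])
    ultimately have "d i * (A' $$ (i, k) * (A' ^\<^sub>m m) $$ (k, j)) = A $$ (i, k) * (A ^\<^sub>m m) $$ (k, j) * d j"
      using jn by (simp add: row distrib_left distrib_right sum_distrib_left sum_distrib_right del: pow_mat.simps)
    then show ?thesis
      using nz(1) by (simp add: c_def field_simps)
  qed
  \<comment> \<open>The dual expansion along column \<open>i\<close>. The row \<open>j\<close> and
    its weight \<open>e\<close> stay free so that it serves both \<open>j\<close> in
    \<open>B\<close> with \<open>e = d j\<close> and \<open>j = k\<close> with \<open>e = c\<close>;
    in the latter case \<open>kB\<close> supplies the premise.\<close>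
  have col_k: "e * (A' ^\<^sub>m m) $$ (j, k) * A' $$ (k, i) = (A ^\<^sub>m m) $$ (j, k) * A $$ (k, i) * d i"
    if j: "j < n" and e: "\<And>l m. l \<in> B \<Longrightarrow> e * (A' ^\<^sub>m m) $$ (j, l) = (A ^\<^sub>m m) $$ (j, l) * d l"
    for j e m
  proof -
    have "(\<Sum>l\<in>B. e * ((A' ^\<^sub>m m) $$ (j, l) * A' $$ (l, i))) = (\<Sum>l\<in>B. (A ^\<^sub>m m) $$ (j, l) * A $$ (l, i) * d i)"
    proof (rule sum.cong)
      fix l assume l: "l \<in> B"
      have "e * ((A' ^\<^sub>m m) $$ (j, l) * A' $$ (l, i)) = (A ^\<^sub>m m) $$ (j, l) * (d l * A' $$ (l, i))"
        using e[OF l] by (simp flip: mult.assoc)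
      also have "\<dots> = (A ^\<^sub>m m) $$ (j, l) * A $$ (l, i) * d i"
        using d1[OF l B(2)] by (simp add: mult.assoc)
      finally show "e * ((A' ^\<^sub>m m) $$ (j, l) * A' $$ (l, i)) = (A ^\<^sub>m m) $$ (j, l) * A $$ (l, i) * d i" .
    qed simp
    moreover have "e * (A' ^\<^sub>m Suc m) $$ (j, i) = (A ^\<^sub>m Suc m) $$ (j, i) * d i"
      by (rule e[OF B(2)])
    ultimately show ?thesis
      using j by (simp add: col distrib_left distrib_right sum_distrib_left sum_distrib_right
          mult.assoc del: pow_mat.simps)
  qed
  \<comment> \<open>This makes \<open>A' $$ (k, i)\<close> a common factor in \<open>col_k\<close>;
    combinatorial symmetry ensures that it is nonzero.\<close>
  have ck: "A $$ (k, i) * d i = c * A' $$ (k, i)"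
    using kB[OF B(2), of 1] A(1) A'(1) by simp
  have Bk: "d j * (A' ^\<^sub>m m) $$ (j, k) = (A ^\<^sub>m m) $$ (j, k) * c" if j: "j \<in> B" for j m
  proof -
    have "d j * (A' ^\<^sub>m m) $$ (j, k) * A' $$ (k, i) = (A ^\<^sub>m m) $$ (j, k) * c * A' $$ (k, i)"
      using col_k[of j "d j" m] dpow j B(1) ck by (auto simp: mult.assoc)
    then show ?thesis
      using nz(4) by simp
  qed
  have kk: "c * (A' ^\<^sub>m m) $$ (k, k) = (A ^\<^sub>m m) $$ (k, k) * c" for m
  proof -
    have "c * (A' ^\<^sub>m m) $$ (k, k) * A' $$ (k, i) = (A ^\<^sub>m m) $$ (k, k) * c * A' $$ (k, i)"
      using col_k[of k c m] kB kn ck by (auto simp: mult.assoc)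
    then show ?thesis
      using nz(4) by simp
  qed
  have "scaled_powers_on A A' (d(k := c)) (insert k B)"
    using k c0 d0 dpow kB Bk kk by (auto simp: scaled_powers_on_def)
  then show ?thesis by blast
qed

section \<open>Iterating the colour change rule\<close>

lemma colour_change_subset_pverts:
  assumes "B \<subseteq> {..<dim_row A}"
  shows "colour_change (matrix_graph A) B \<subseteq> {..<dim_row A}"
proof -
  have "neighbours (matrix_graph A) i \<subseteq> {..<dim_row A}" for i
    by (auto simp: matrix_graph_def neighbours_iff)
  then show ?thesis
    using assms unfolding colour_change_def by blast
qed

text \<open>The simultaneous forces of a round can be applied one after another: once the vertices
  of \<open>J\<close> are blue too, \<open>neighbours ?G i - (B \<union> J)\<close> is still
  \<open>{k}\<close> as long as \<open>k\<close> is not in \<open>J\<close>.\<close>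

lemma scaled_powers_on_colour_change:
  fixes A A' :: "'a :: field mat"
  assumes A: "A \<in> carrier_mat n n" "combinatorially_symmetric A"
    and A': "A' \<in> carrier_mat n n" "combinatorially_symmetric A'"
    and graph: "matrix_graph A' = matrix_graph A"
    and B: "B \<subseteq> {..<n}"
    and d: "\<exists>d. scaled_powers_on A A' d B"
  shows "\<exists>d. scaled_powers_on A A' d (colour_change (matrix_graph A) B)"
proof -
  let ?G = "matrix_graph A"
  have sub: "{j. \<exists>i\<in>B. neighbours ?G i - B = {j}} \<subseteq> {..<n}"
    using colour_change_subset_pverts[of B A] A(1) B by (simp add: colour_change_def)
  have step: "\<exists>d. scaled_powers_on A A' d (B \<union> J)"
    if "finite J" "J \<subseteq> {j. \<exists>i\<in>B. neighbours ?G i - B = {j}}" for J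
    using that
  proof (induction J rule: finite_induct)
    case empty
    then show ?case using d by simp
  next
    case (insert k J)
    then obtain d i where d: "scaled_powers_on A A' d (B \<union> J)"
      and i: "i \<in> B" "neighbours ?G i - B = {k}"
      by auto
    have "J \<subseteq> {..<n}"
      using insert.prems sub by blast
    then show ?case
      using scaled_powers_on_force[OF A A' graph, of "B \<union> J" i k d] d i insert.hyps B by auto
  qed
  from sub have "finite {j. \<exists>i\<in>B. neighbours ?G i - B = {j}}"
    by (rule finite_subset) simp
  then show ?thesis
    unfolding colour_change_def by (intro step) auto
qed

lemma scaled_powers_on_zero_forcing_set:
  fixes A A' :: "'a :: field mat"
  assumes A: "A \<in> carrier_mat n n" "combinatorially_symmetric A"
    and A': "A' \<in> carrier_mat n n" "combinatorially_symmetric A'"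
    and graph: "matrix_graph A' = matrix_graph A"
    and Z: "zero_forcing_set (matrix_graph A) Z"
    and d: "scaled_powers_on A A' d Z"
  shows "\<exists>d. scaled_powers_on A A' d {..<n}"
proof -
  let ?B = "\<lambda>t. (colour_change (matrix_graph A) ^^ t) Z"
  have "?B t \<subseteq> {..<n} \<and> (\<exists>d. scaled_powers_on A A' d (?B t))" for t
  proof (induction t)
    case 0
    then show ?case
      using A(1) Z d by (auto simp: zero_forcing_set_def matrix_graph_def)
  next
    case (Suc t)
    then show ?case
      using scaled_powers_on_colour_change[OF A A' graph, of "?B t"]
        colour_change_subset_pverts[of "?B t" A] A(1) by simp
  qed
  moreover obtain t where "?B t = {..<n}"
    using Z A(1) by (auto simp: zero_forcing_set_def matrix_graph_def)
  ultimately show ?thesis by metis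
qed

section \<open>Maximum principle on a connected graph\<close>

text \<open>Connectedness is defined through the symmetric closure, but the arcs are already
  symmetric, so \<open>j\<close> is reachable from \<open>i\<close> and \<open>Q\<close> spreads
  along the walk.\<close>

lemma connected_matrix_graph_induct:
  assumes "Digraph_Component.connected (with_proj (matrix_graph M))"
    and "i < dim_row M" "j < dim_row M"
    and "Q i"
    and "\<And>u v. Q u \<Longrightarrow> (u, v) \<in> parcs (matrix_graph M) \<Longrightarrow> Q v"
  shows "Q j"
proof -
  interpret pair_graph "matrix_graph M"
    by (rule pair_graph_matrix_graph)
  have "i \<rightarrow>\<^sup>*\<^bsub>mk_symmetric (with_proj (matrix_graph M))\<^esub> j"
    using assms(1-3) by (auto simp: connected_def strongly_connected_def matrix_graph_def)
  then have "i \<rightarrow>\<^sup>*\<^bsub>with_proj (matrix_graph M)\<^esub> j"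
    using sym_arcs by (simp add: reachable_mk_symmetric_eq)
  then show ?thesis
  proof (induction rule: reachable_induct)
    case base
    then show ?case using assms(4) by simp
  next
    case (step u v)
    then show ?case using assms(5) by (auto simp: arcs_ends_def arc_to_ends_def)
  qed
qed

text \<open>Where \<open>h\<close> attains its maximum \<open>m\<close>, the weighted mean of the
  nonnegative numbers \<open>m - h j\<close> is zero, so \<open>h\<close> equals \<open>m\<close> at
  every neighbour as well; connectedness carries this to all vertices.\<close>

lemma harmonic_imp_constant:
  fixes P :: "real mat"
  assumes P: "P \<in> carrier_mat n n" "row_stochastic P" "combinatorially_symmetric P"
    and conn: "Digraph_Component.connected (with_proj (matrix_graph P))"
    and harmonic: "\<And>i. i < n \<Longrightarrow> h i = (\<Sum>j<n. P $$ (i, j) * h j)"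
    and ij: "i < n" "j < n"
  shows "h i = h j"
proof -
  define m where "m = Max (h ` {..<n})"
  have le: "h u \<le> m" if "u < n" for u
    using that by (auto simp: m_def)
  have "m \<in> h ` {..<n}"
    using ij unfolding m_def by (intro Max_in) auto
  then obtain u0 where u0: "u0 < n" "h u0 = m" by auto
  have step: "h v = m" if u: "h u = m" and uv: "(u, v) \<in> parcs (matrix_graph P)" for u v
  proof -
    have n: "u < n" "v < n" and nz: "P $$ (u, v) \<noteq> 0"
      using uv P by (auto simp: arc_matrix_graph_iff)
    have "(\<Sum>j<n. P $$ (u, j) * (m - h j)) = (\<Sum>j<n. P $$ (u, j)) * m - h u"
      using harmonic[OF n(1)] by (simp add: right_diff_distrib sum_subtractf sum_distrib_right)
    also have "\<dots> = 0"
      using P n u by (simp add: row_stochastic_def)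
    finally have "\<forall>j\<in>{..<n}. P $$ (u, j) * (m - h j) = 0"
      using P n le by (subst (asm) sum_nonneg_eq_0_iff) (auto simp: row_stochastic_def)
    then show ?thesis
      using n nz by auto
  qed
  have "h u = m" if "u < n" for u
    using connected_matrix_graph_induct[of P u0 u "\<lambda>u. h u = m"] conn u0 that step P(1) by auto
  then show ?thesis using ij by simp
qed

theorem theorem1:
  fixes S :: nat and P P' :: "real mat" and Z :: "nat set"
  assumes "P \<in> carrier_mat S S"
    and "row_stochastic P"
    and "combinatorially_symmetric P"
    and "Digraph_Component.connected (with_proj (matrix_graph P))"
    and "Z \<subseteq> {..<S}"
    and "zero_forcing_set (matrix_graph P) Z"
    and "P' \<in> carrier_mat S S"
    and "row_stochastic P'"
    and "combinatorially_symmetric P'"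
    and "matrix_graph P' = matrix_graph P"
    and "\<forall>i\<in>Z. \<forall>j\<in>Z. \<forall>n::nat. (P' ^\<^sub>m n) $$ (i, j) = (P ^\<^sub>m n) $$ (i, j)"
  shows "P' = P"
proof -
  have "scaled_powers_on P P' (\<lambda>_. 1) Z"
    using assms(11) by (simp add: scaled_powers_on_def)
  then obtain d where d: "scaled_powers_on P P' d {..<S}"
    using scaled_powers_on_zero_forcing_set[OF assms(1,3,7,9,10,6)] by blast
  have d0: "d i \<noteq> 0" if "i < S" for i
    using d that by (simp add: scaled_powers_on_def)
  have d1: "d i * P' $$ (i, j) = P $$ (i, j) * d j" if "i < S" "j < S" for i j
  proof -
    have "d i * (P' ^\<^sub>m 1) $$ (i, j) = (P ^\<^sub>m 1) $$ (i, j) * d j"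
      using d that unfolding scaled_powers_on_def by blast
    then show ?thesis
      using assms(1,7) by simp
  qed
  \<comment> \<open>Sum \<open>d1\<close> over \<open>j\<close>: the row sum 1 of \<open>P'\<close>
    leaves \<open>d i\<close> on the left.\<close>
  have "d i = (\<Sum>j<S. P $$ (i, j) * d j)" if i: "i < S" for i
  proof -
    have "(\<Sum>j<S. P $$ (i, j) * d j) = d i * (\<Sum>j<S. P' $$ (i, j))"
      using i d1 by (simp add: sum_distrib_left)
    then show ?thesis
      using assms(7,8) i by (simp add: row_stochastic_def)
  qed
  then have "d i = d j" if "i < S" "j < S" for i j
    using harmonic_imp_constant[OF assms(1-4)] that by blast
  \<comment> \<open>A constant nonzero scaling cancels from \<open>d1\<close>.\<close>
  then have "P' $$ (i, j) = P $$ (i, j)" if "i < S" "j < S" for i j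
    using d1[OF that] d0 that by (metis mult.commute mult_cancel_left)
  then show ?thesis
    using assms(1,7) by (intro eq_matI) auto
qed

end
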